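(* Let $p$ be a prime and let $\mathbb{F}_p\operatorname{wr}\mathbb{Z}$ be the lamplighter group. The inert subgroups of $\mathbb{F}_p\operatorname{wr}\mathbb{Z}$ fall into exactly five commensurability classes.
   Context: For a prime $p$, the lamplighter group $\mathbb{F}_p\operatorname{wr}\mathbb{Z}$ is the standard restricted wreath product of a group of order $p$ by an infinite cyclic group, i.e. the semidirect product $\left(\bigoplus_{\mathbb{Z}}\mathbb{F}_p\right)\rtimes\mathbb{Z}$ with $\mathbb{Z}$ acting by shifting coordinates. Two subgroups $H,L$ of a group $G$ are commensurate if $H\cap L$ has finite index in both $H$ and $L$; this is an equivalence relation on the subgroups of $G$, and its equivalence classes are called (commensurability) classes. A subgroup $H$ of $G$ is inert if $H$ and $H^g=g^{-1}Hg$ are commensurate for all $g\in G$. *)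

theory Defs
  imports "HOL-Algebra.Algebra"
begin

text \<open>
  The action \<open>\<phi>\<close> of \<open>Q\<close> on \<open>N\<close> is a left action by automorphisms, so that
  \<open>(1, q) (n, 1) (1, q)\<inverse> = (\<phi> q n, 1)\<close>.
\<close>

definition semidirect_product ::
    "('n, 'c) monoid_scheme \<Rightarrow> ('q, 'd) monoid_scheme \<Rightarrow> ('q \<Rightarrow> 'n \<Rightarrow> 'n) \<Rightarrow> ('n \<times> 'q) monoid"
  where "semidirect_product N Q \<phi> =
    \<lparr>carrier = carrier N \<times> carrier Q,
     monoid.mult = (\<lambda>(m, q) (n, r). (m \<otimes>\<^bsub>N\<^esub> \<phi> q n, q \<otimes>\<^bsub>Q\<^esub> r)),
     one = (\<one>\<^bsub>N\<^esub>, \<one>\<^bsub>Q\<^esub>)\<rparr>"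

lemma group_semidirect_product:
  assumes "group N" and "group Q"
    and hom: "\<And>q. q \<in> carrier Q \<Longrightarrow> \<phi> q \<in> hom N N"
    and one: "\<And>n. n \<in> carrier N \<Longrightarrow> \<phi> \<one>\<^bsub>Q\<^esub> n = n"
    and mult: "\<And>q r n. \<lbrakk>q \<in> carrier Q; r \<in> carrier Q; n \<in> carrier N\<rbrakk> \<Longrightarrow>
                 \<phi> (q \<otimes>\<^bsub>Q\<^esub> r) n = \<phi> q (\<phi> r n)"
  shows "group (semidirect_product N Q \<phi>)"
proof -
  interpret N: group N by fact
  interpret Q: group Q by fact
  have closed: "\<phi> q n \<in> carrier N" if "q \<in> carrier Q" "n \<in> carrier N" for q n
    using hom[OF that(1)] that(2) by (rule hom_in_carrier)
  have distrib: "\<phi> q (m \<otimes>\<^bsub>N\<^esub> n) = \<phi> q m \<otimes>\<^bsub>N\<^esub> \<phi> q n"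
    if "q \<in> carrier Q" "m \<in> carrier N" "n \<in> carrier N" for q m n
    using hom[OF that(1)] that(2,3) by (rule hom_mult)
  show ?thesis
  proof (rule groupI, goal_cases)
    case (3 x y z)
    then show ?case
      by (auto simp: semidirect_product_def closed distrib mult N.m_assoc Q.m_assoc)
  next
    case (4 x)
    then show ?case
      by (auto simp: semidirect_product_def one)
  next
    case (5 x)
    then obtain n q where x: "x = (n, q)" "n \<in> carrier N" "q \<in> carrier Q"
      by (auto simp: semidirect_product_def)
    let ?y = "(\<phi> (inv\<^bsub>Q\<^esub> q) (inv\<^bsub>N\<^esub> n), inv\<^bsub>Q\<^esub> q)"
    have "\<phi> (inv\<^bsub>Q\<^esub> q) (inv\<^bsub>N\<^esub> n) \<otimes>\<^bsub>N\<^esub> \<phi> (inv\<^bsub>Q\<^esub> q) n = \<phi> (inv\<^bsub>Q\<^esub> q) \<one>\<^bsub>N\<^esub>"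
      using x by (simp flip: distrib)
    also have "\<dots> = \<one>\<^bsub>N\<^esub>"
      using x hom N.group_axioms by (simp add: hom_one)
    finally have "?y \<otimes>\<^bsub>semidirect_product N Q \<phi>\<^esub> x = \<one>\<^bsub>semidirect_product N Q \<phi>\<^esub>"
      using x by (simp add: semidirect_product_def)
    moreover have "?y \<in> carrier (semidirect_product N Q \<phi>)"
      using x by (simp add: semidirect_product_def closed)
    ultimately show ?case by blast
  qed (auto simp: semidirect_product_def closed)
qed

definition shift :: "int \<Rightarrow> (int \<Rightarrow> 'a) \<Rightarrow> int \<Rightarrow> 'a"
  where "shift k f = (\<lambda>i. f (i - k))"

definition lamplighter_group :: "nat \<Rightarrow> ((int \<Rightarrow> int) \<times> int) monoid"
  where "lamplighter_group p =
    semidirect_product (sum_group UNIV (\<lambda>_. integer_mod_group p)) integer_group shift"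

lemma group_lamplighter_group: "group (lamplighter_group p)"
  unfolding lamplighter_group_def
proof (rule group_semidirect_product, goal_cases)
  case (3 k)
  have "finite {i. f (i - k) \<noteq> \<one>\<^bsub>integer_mod_group p\<^esub>}"
    if "finite {i. f i \<noteq> \<one>\<^bsub>integer_mod_group p\<^esub>}" for f :: "int \<Rightarrow> int"
  proof -
    have "{i. f (i - k) \<noteq> \<one>\<^bsub>integer_mod_group p\<^esub>} =
          (\<lambda>i. i + k) ` {i. f i \<noteq> \<one>\<^bsub>integer_mod_group p\<^esub>}"
      by (force simp: image_iff intro: exI[of _ "_ - k"])
    then show ?thesis using that by simp
  qed
  then show ?case
    by (intro homI) (auto simp: carrier_sum_group shift_def PiE_iff)
qed (simp_all add: shift_def algebra_simps)

text \<open>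
  For subgroups \<open>K \<subseteq> H\<close> of \<open>G\<close>: the set of right cosets of \<open>K\<close> in \<open>H\<close> is finite.
\<close>

definition finite_index_in :: "('a, 'b) monoid_scheme \<Rightarrow> 'a set \<Rightarrow> 'a set \<Rightarrow> bool"
  where "finite_index_in G K H \<longleftrightarrow> finite (rcosets\<^bsub>G\<lparr>carrier := H\<rparr>\<^esub> K)"

definition commensurate :: "('a, 'b) monoid_scheme \<Rightarrow> 'a set \<Rightarrow> 'a set \<Rightarrow> bool"
  where "commensurate G H L \<longleftrightarrow> finite_index_in G (H \<inter> L) H \<and> finite_index_in G (H \<inter> L) L"

definition commensurability :: "('a, 'b) monoid_scheme \<Rightarrow> ('a set \<times> 'a set) set"
  where "commensurability G = {(H, L). subgroup H G \<and> subgroup L G \<and> commensurate G H L}"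

definition conjugate_subgroup :: "('a, 'b) monoid_scheme \<Rightarrow> 'a set \<Rightarrow> 'a \<Rightarrow> 'a set"
  where "conjugate_subgroup G H g = inv\<^bsub>G\<^esub> g <#\<^bsub>G\<^esub> (H #>\<^bsub>G\<^esub> g)"

definition inert_subgroup :: "'a set \<Rightarrow> ('a, 'b) monoid_scheme \<Rightarrow> bool"
  where "inert_subgroup H G \<longleftrightarrow>
    subgroup H G \<and> (\<forall>g \<in> carrier G. commensurate G H (conjugate_subgroup G H g))"

end

theory Submission
  imports Defs
begin

text \<open>
  Write the base group of the lamplighter group \<open>G\<close> as the additive group of Laurent polynomials
  \<open>F_p[t, 1/t]\<close>, so that the generator of \<open>\<int>\<close> acts as multiplication by \<open>t\<close>. The five classes are
  represented by the trivial group, \<open>F_p[t]\<close>, \<open>F_p[1/t]\<close>, the whole base group, and \<open>G\<close>. In the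
  formalization the first four are the groups \<open>base S\<close> of polynomials supported in \<open>S\<close>, for
  \<open>S = {}, {0..}, {..0}, UNIV\<close>. Commensurability is split into two instances of a preorder: \<open>H\<close>
  is almost contained in \<open>L\<close> if finitely many translates of \<open>L\<close> cover \<open>H\<close>.

  Let \<open>H\<close> be an inert subgroup of the base group. Conjugation by \<open>t\<close> shows that, up to an error
  supported in a fixed window \<open>{-m..m}\<close>, multiplication by \<open>t\<close> maps \<open>H\<close> to itself; likewise for
  \<open>1/t\<close>. If some element of \<open>H\<close> has degree above \<open>m\<close>, then multiplying by \<open>t\<close> and correcting the
  error again and again raises its degree by one each time, since the error lies below the top
  term, while its lowest term moves up until it is caught by the window. Hence \<open>H\<close> has
  elements of every large degree whose lowest terms are bounded below, and division with remainder
  shows that \<open>F_p[t]\<close> is almost contained in \<open>H\<close>. So either the degrees in \<open>H\<close> are bounded above, or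
  \<open>F_p[t]\<close> is almost contained in \<open>H\<close> (\<open>half_line_dichotomy\<close>). Together with the mirror image of
  this dichotomy, this leaves four cases, which are the first four classes
  (\<open>inert_subgroup_of_base\<close>).

  Let \<open>H\<close> be an inert subgroup with an element \<open>h\<close> outside the base group, mapping to \<open>k > 0\<close> in
  \<open>\<int>\<close>. For each \<open>c\<close> in the base group some positive power \<open>h^n\<close> lies in the conjugate of \<open>H\<close> by
  \<open>c\<close>, and multiplying the conjugate \<open>c h^n c^(-1) \<in> H\<close> by \<open>h^(-n)\<close> gives \<open>(1 - t^(kn)) c \<in> H\<close>
  (\<open>inert_subgroup_torsion\<close>). For \<open>c = t^i\<close> this identifies \<open>t^i\<close> with \<open>t^(i+kn)\<close> modulo \<open>H\<close>, where
  \<open>n\<close> depends on \<open>i\<close>. Since \<open>H\<close> intersected with the base group is invariant under \<open>t^k\<close>, the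
  monomials fall into finitely many classes modulo \<open>H\<close>. So the base group is almost contained in
  \<open>H\<close>, and then so is \<open>G\<close>.

  The five representatives are inert and pairwise not commensurate, because \<open>base S\<close> is almost
  contained in \<open>base T\<close> if and only if \<open>S - T\<close> is finite (\<open>base_almost_contained_iff\<close>), and no group
  \<open>base S\<close> almost contains \<open>G\<close>.
\<close>

section \<open>Commensurability as mutual almost containment\<close>

text \<open>
  The translates of \<open>L\<close> are taken in the whole group rather than in \<open>H\<close>; this makes transitivity
  immediate, and for subgroups it describes the same relation as a finite index of \<open>H \<inter> L\<close> in
  \<open>H\<close> (\<open>finite_index_inter_iff\<close>).
\<close>

definition almost_contained :: "('a, 'b) monoid_scheme \<Rightarrow> 'a set \<Rightarrow> 'a set \<Rightarrow> bool"
  where "almost_contained G H L \<longleftrightarrow> (\<exists>F. finite F \<and> F \<subseteq> carrier G \<and> H \<subseteq> L <#>\<^bsub>G\<^esub> F)"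

context group
begin

lemma almost_containedI:
  assumes "finite F" "F \<subseteq> carrier G"
    and "\<And>h. h \<in> H \<Longrightarrow> \<exists>l \<in> L. \<exists>x \<in> F. h = l \<otimes> x"
  shows "almost_contained G H L"
proof -
  have "H \<subseteq> L <#> F"
    using assms(3) by (fastforce simp: set_mult_def)
  with assms(1,2) show ?thesis
    unfolding almost_contained_def by blast
qed

lemma almost_containedE:
  assumes "almost_contained G H L"
  obtains F where "finite F" "F \<subseteq> carrier G"
    "\<And>h. h \<in> H \<Longrightarrow> \<exists>l \<in> L. \<exists>x \<in> F. h = l \<otimes> x"
proof -
  obtain F where F: "finite F" "F \<subseteq> carrier G" "H \<subseteq> L <#> F"
    using assms unfolding almost_contained_def by blast
  show thesis
    by (rule that[OF F(1,2)]) (use F(3) in \<open>fastforce simp: set_mult_def\<close>)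
qed

lemma almost_contained_subset:
  assumes "H \<subseteq> L" "L \<subseteq> carrier G"
  shows "almost_contained G H L"
proof (rule almost_containedI)
  fix h assume "h \<in> H"
  then have "h \<in> L" "h = h \<otimes> \<one>"
    using assms by auto
  then show "\<exists>l\<in>L. \<exists>x\<in>{\<one>}. h = l \<otimes> x" by blast
qed auto

lemma almost_contained_trans:
  assumes "almost_contained G H L" "almost_contained G L K" "K \<subseteq> carrier G"
  shows "almost_contained G H K"
proof -
  obtain E where E: "finite E" "E \<subseteq> carrier G" "H \<subseteq> L <#> E"
    using assms(1) unfolding almost_contained_def by blast
  obtain F where F: "finite F" "F \<subseteq> carrier G" "L \<subseteq> K <#> F"
    using assms(2) unfolding almost_contained_def by blast
  have "L <#> E \<subseteq> K <#> F <#> E"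
    using F(3) by (rule mono_set_mult) simp
  then have "H \<subseteq> K <#> (F <#> E)"
    using E F assms(3) by (simp add: set_mult_assoc)
  moreover have "finite (F <#> E)"
    using E(1) F(1) unfolding set_mult_def by simp
  moreover have "F <#> E \<subseteq> carrier G"
    using F(2) E(2) by (rule set_mult_closed)
  ultimately show ?thesis
    unfolding almost_contained_def by (intro exI[of _ "F <#> E"]) simp
qed

text \<open>
  Two elements of \<open>H\<close> in the same coset of \<open>L\<close> differ by an element of \<open>H \<inter> L\<close>, so each of the
  finitely many translates of \<open>L\<close> that cover \<open>H\<close> contributes at most one coset of \<open>H \<inter> L\<close>.
\<close>

lemma finite_index_inter_iff:
  assumes "subgroup H G" "subgroup L G"
  shows "finite_index_in G (H \<inter> L) H \<longleftrightarrow> almost_contained G H L"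
proof -
  interpret H: subgroup H G by fact
  interpret L: subgroup L G by fact
  interpret K: subgroup "H \<inter> L" G using assms by (rule subgroups_Inter_pair)
  have rcosets_eq: "rcosets\<^bsub>G\<lparr>carrier := H\<rparr>\<^esub> (H \<inter> L) = (\<lambda>h. (H \<inter> L) #> h) ` H"
    by (auto simp: RCOSETS_def r_coset_def)
  show ?thesis
    unfolding finite_index_in_def rcosets_eq
  proof
    assume "finite ((\<lambda>h. (H \<inter> L) #> h) ` H)"
    then obtain F where F: "F \<subseteq> H" "finite F"
        "(\<lambda>h. (H \<inter> L) #> h) ` H = (\<lambda>h. (H \<inter> L) #> h) ` F"
      using finite_subset_image[OF _ subset_refl] by metis
    show "almost_contained G H L"
    proof (rule almost_containedI)
      fix h assume h: "h \<in> H"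
      then obtain x where x: "x \<in> F" "(H \<inter> L) #> h = (H \<inter> L) #> x"
        using F(3) by (metis (no_types, lifting) image_iff)
      have "h \<in> (H \<inter> L) #> x"
        unfolding x(2)[symmetric] using h K.subgroup_axioms by (intro rcos_self) auto
      then obtain k where "k \<in> H \<inter> L" "h = k \<otimes> x"
        unfolding r_coset_def by auto
      then show "\<exists>l\<in>L. \<exists>x\<in>F. h = l \<otimes> x"
        using x(1) by auto
    qed (use F in auto)
  next
    assume "almost_contained G H L"
    then obtain F where F: "finite F" "F \<subseteq> carrier G"
        "\<And>h. h \<in> H \<Longrightarrow> \<exists>l\<in>L. \<exists>x\<in>F. h = l \<otimes> x"
      by (rule almost_containedE) blast
    have eq: "(H \<inter> L) #> h = (H \<inter> L) #> h'"
      if xF: "x \<in> F" and h: "h \<in> H \<inter> (L #> x)" "h' \<in> H \<inter> (L #> x)" for x h h'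
    proof -
      obtain l l' where l: "l \<in> L" "l' \<in> L" "h = l \<otimes> x" "h' = l' \<otimes> x"
        using h unfolding r_coset_def by auto
      have x: "x \<in> carrier G" using \<open>x \<in> F\<close> F(2) by blast
      have "x \<otimes> (inv x \<otimes> inv l') = inv l'"
        using x l(2) by (simp flip: m_assoc)
      then have "h \<otimes> inv h' = l \<otimes> inv l'"
        using x l by (simp add: inv_mult_group m_assoc)
      then have "h \<otimes> inv h' \<in> L"
        using l by simp
      then have "h \<otimes> inv h' \<in> H \<inter> L"
        using h by auto
      moreover have "h = (h \<otimes> inv h') \<otimes> h'"
        using h by (simp add: m_assoc)
      ultimately have "h \<in> (H \<inter> L) #> h'"
        unfolding r_coset_def by blast
      then show ?thesis
        using h(2) K.subgroup_axioms by (intro repr_independence[symmetric]) auto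
    qed
    have "finite ((\<lambda>h. (H \<inter> L) #> h) ` (H \<inter> (L #> x)))" if "x \<in> F" for x
    proof (cases "H \<inter> (L #> x) = {}")
      case False
      then obtain y where "y \<in> H \<inter> (L #> x)" by blast
      then have "(\<lambda>h. (H \<inter> L) #> h) ` (H \<inter> (L #> x)) \<subseteq> {(H \<inter> L) #> y}"
        using eq[OF \<open>x \<in> F\<close>] by blast
      then show ?thesis by (rule finite_subset) simp
    qed simp
    moreover have "(\<lambda>h. (H \<inter> L) #> h) ` H \<subseteq> (\<Union>x\<in>F. (\<lambda>h. (H \<inter> L) #> h) ` (H \<inter> (L #> x)))"
      using F(3) by (fastforce simp: r_coset_def)
    ultimately show "finite ((\<lambda>h. (H \<inter> L) #> h) ` H)"
      using F(1) by (meson finite_UN_I finite_subset)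
  qed
qed

lemma commensurate_iff:
  assumes "subgroup H G" "subgroup L G"
  shows "commensurate G H L \<longleftrightarrow> almost_contained G H L \<and> almost_contained G L H"
  using finite_index_inter_iff[OF assms] finite_index_inter_iff[OF assms(2,1)]
  by (simp add: commensurate_def Int_commute)

lemma commensurability_class_eq_iff:
  assumes "subgroup H G" "subgroup L G"
  shows "commensurability G `` {H} = commensurability G `` {L} \<longleftrightarrow> commensurate G H L"
proof -
  have mem: "K \<in> commensurability G `` {H'} \<longleftrightarrow>
      subgroup K G \<and> almost_contained G H' K \<and> almost_contained G K H'"
    if "subgroup H' G" for H' K
    using that by (auto simp: commensurability_def commensurate_iff)
  note incl = subgroup.subset
  show ?thesis
  proof
    assume "commensurability G `` {H} = commensurability G `` {L}"
    moreover have "L \<in> commensurability G `` {L}"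
      unfolding mem[OF assms(2)] using assms by (simp add: almost_contained_subset incl)
    ultimately have "L \<in> commensurability G `` {H}" by simp
    then show "commensurate G H L"
      by (simp add: commensurability_def)
  next
    assume "commensurate G H L"
    then show "commensurability G `` {H} = commensurability G `` {L}"
      using assms unfolding set_eq_iff mem[OF assms(1)] mem[OF assms(2)]
      by (meson almost_contained_trans commensurate_iff incl)
  qed
qed

lemma mem_conjugate_subgroup_iff:
  assumes "H \<subseteq> carrier G" "g \<in> carrier G"
  shows "x \<in> conjugate_subgroup G H g \<longleftrightarrow> x \<in> carrier G \<and> g \<otimes> x \<otimes> inv g \<in> H"
proof
  assume "x \<in> conjugate_subgroup G H g"
  then obtain h where "h \<in> H" "x = inv g \<otimes> (h \<otimes> g)"
    by (auto simp: conjugate_subgroup_def l_coset_def r_coset_def)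
  then show "x \<in> carrier G \<and> g \<otimes> x \<otimes> inv g \<in> H"
    using assms by (auto simp: m_assoc subset_iff) (simp flip: m_assoc)
next
  assume x: "x \<in> carrier G \<and> g \<otimes> x \<otimes> inv g \<in> H"
  then have "x = inv g \<otimes> ((g \<otimes> x \<otimes> inv g) \<otimes> g)"
    using assms by (simp add: m_assoc) (simp flip: m_assoc)
  then show "x \<in> conjugate_subgroup G H g"
    using x by (auto simp: conjugate_subgroup_def l_coset_def r_coset_def)
qed

lemma subgroup_conjugate_subgroup:
  assumes "subgroup H G" "g \<in> carrier G"
  shows "subgroup (conjugate_subgroup G H g) G"
proof -
  interpret H: subgroup H G by fact
  note iff = mem_conjugate_subgroup_iff[OF H.subset assms(2)]
  show ?thesis
  proof (rule subgroupI)
    have "\<one> \<in> conjugate_subgroup G H g"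
      using assms(2) by (simp add: iff)
    then show "conjugate_subgroup G H g \<noteq> {}" by blast
  next
    fix x assume x: "x \<in> conjugate_subgroup G H g"
    then have "g \<otimes> inv x \<otimes> inv g = inv (g \<otimes> x \<otimes> inv g)"
      using assms(2) by (simp add: iff inv_mult_group m_assoc)
    then show "inv x \<in> conjugate_subgroup G H g"
      using x by (simp add: iff)
  next
    fix x y assume xy: "x \<in> conjugate_subgroup G H g" "y \<in> conjugate_subgroup G H g"
    then have "g \<otimes> (x \<otimes> y) \<otimes> inv g = (g \<otimes> x \<otimes> inv g) \<otimes> (g \<otimes> y \<otimes> inv g)"
      using assms(2) by (simp add: iff m_assoc inv_solve_left)
    then show "x \<otimes> y \<in> conjugate_subgroup G H g"
      using xy by (simp add: iff)
  qed (auto simp: iff)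
qed

lemma inert_subgroup_iff:
  "inert_subgroup H G \<longleftrightarrow> subgroup H G \<and> (\<forall>g \<in> carrier G.
     almost_contained G H (conjugate_subgroup G H g) \<and>
     almost_contained G (conjugate_subgroup G H g) H)"
  unfolding inert_subgroup_def
  by (auto simp: commensurate_iff subgroup_conjugate_subgroup)

text \<open>
  By the pigeonhole principle two powers of \<open>h\<close> lie in the same translate of \<open>L\<close>, and their quotient
  is the required power.
\<close>

lemma almost_contained_imp_power_mem:
  assumes "almost_contained G H L" "subgroup H G" "subgroup L G" "h \<in> H"
  obtains n :: nat where "n > 0" "h [^] n \<in> L"
proof -
  interpret H: subgroup H G by fact
  interpret L: subgroup L G by fact
  obtain F where F: "finite F" "F \<subseteq> carrier G"
      "\<And>h. h \<in> H \<Longrightarrow> \<exists>l\<in>L. \<exists>x\<in>F. h = l \<otimes> x"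
    using assms(1) by (rule almost_containedE) blast
  have pow_mem: "h [^] n \<in> H" for n :: nat
    using assms(4) by (induction n) auto
  then have "\<exists>x. x \<in> F \<and> (\<exists>l\<in>L. h [^] n = l \<otimes> x)" for n :: nat
    using F(3) by blast
  then obtain x where x: "\<And>n::nat. x n \<in> F" "\<And>n. \<exists>l\<in>L. h [^] n = l \<otimes> x n"
    by metis
  have "\<not> inj x"
  proof
    assume "inj x"
    moreover have "finite (range x)"
      using x(1) by (intro finite_subset[OF _ F(1)]) auto
    ultimately show False
      by (simp add: finite_image_iff)
  qed
  then obtain i j where ij: "i < j" "x i = x j"
    by (metis injI linorder_neqE_nat)
  obtain l l' where l: "l \<in> L" "h [^] i = l \<otimes> x i" "l' \<in> L" "h [^] j = l' \<otimes> x i"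
    using x(2)[of i] x(2)[of j] ij(2) by auto
  have carr: "h \<in> carrier G" "x i \<in> carrier G" "l \<in> carrier G" "l' \<in> carrier G"
    using assms(4) x(1) F(2) l by auto
  have "h [^] (j - i) \<otimes> h [^] i = h [^] j"
    using ij(1) carr by (simp add: nat_pow_mult)
  then have "(h [^] (j - i) \<otimes> l) \<otimes> x i = l' \<otimes> x i"
    using l carr by (simp add: m_assoc)
  then have "h [^] (j - i) \<otimes> l = l'"
    using carr by simp
  then have "h [^] (j - i) = l' \<otimes> inv l"
    using carr by (simp add: inv_solve_right)
  then have "h [^] (j - i) \<in> L"
    using l by simp
  then show thesis
    using ij(1) by (intro that[of "j - i"]) auto
qed

end

section \<open>Coordinates in the lamplighter group\<close>

lemma finite_int_subset_interval:
  fixes S :: "int set"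
  assumes "finite S"
  obtains N where "N \<ge> 0" "S \<subseteq> {-N..N}"
proof -
  obtain k where k: "abs ` S \<subseteq> {..k}"
    using assms finite_int_iff_bounded_le by blast
  then have "S \<subseteq> {-max 0 k..max 0 k}" by fastforce
  then show thesis by (rule that[rotated]) simp
qed

locale lamplighter =
  fixes p :: nat
  assumes prime: "Factorial_Ring.prime p"
begin

abbreviation G where "G \<equiv> lamplighter_group p"

sublocale group "lamplighter_group p"
  by (rule group_lamplighter_group)

definition supp :: "(int \<Rightarrow> int) \<Rightarrow> int set"
  where "supp f = {i. \<not> int p dvd f i}"

text \<open>
  Lamp configurations are given by arbitrary integer-valued functions, read modulo \<open>p\<close>. So the
  arithmetic of the group needs no reduction, and supports and equality are stated through
  divisibility by \<open>p\<close>.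
\<close>

definition elt :: "(int \<Rightarrow> int) \<Rightarrow> int \<Rightarrow> (int \<Rightarrow> int) \<times> int"
  where "elt f k = ((\<lambda>i. f i mod int p), k)"

definition base :: "int set \<Rightarrow> ((int \<Rightarrow> int) \<times> int) set"
  where "base S = {elt f 0 | f. finite (supp f) \<and> supp f \<subseteq> S}"

lemma p_gt_1: "int p > 1"
  using prime_gt_1_nat[OF prime] by simp

lemma mem_supp_iff: "i \<in> supp f \<longleftrightarrow> \<not> int p dvd f i"
  by (simp add: supp_def)

lemma supp_zero [simp]: "supp (\<lambda>_. 0) = {}"
  by (simp add: supp_def)

lemma supp_add: "supp (\<lambda>i. f i + g i) \<subseteq> supp f \<union> supp g"
  by (auto simp: supp_def)

lemma supp_diff: "supp (\<lambda>i. f i - g i) \<subseteq> supp f \<union> supp g"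
  by (auto simp: supp_def)

lemma supp_minus [simp]: "supp (\<lambda>i. - f i) = supp f"
  by (simp add: supp_def)

lemma supp_shift_right: "supp (\<lambda>i. f (i - k)) = (\<lambda>i. i + k) ` supp f"
  by (force simp: supp_def image_iff intro: exI[of _ "_ - k"])

lemma supp_shift_left: "supp (\<lambda>i. f (i + k)) = (\<lambda>i. i - k) ` supp f"
  by (force simp: supp_def image_iff intro: exI[of _ "_ + k"])

lemma supp_reflect: "supp (\<lambda>i. f (- i)) = uminus ` supp f"
  by (force simp: supp_def image_iff intro: exI[of _ "- _"])

lemma mod_carrier_iff:
  "(\<lambda>i. f i mod int p) \<in> carrier (sum_group UNIV (\<lambda>_. integer_mod_group p)) \<longleftrightarrow> finite (supp f)"
  using p_gt_1
  by (simp add: carrier_sum_group carrier_integer_mod_group supp_def PiE_iff dvd_eq_mod_eq_0)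

lemma elt_mem_carrier_iff: "elt f k \<in> carrier G \<longleftrightarrow> finite (supp f)"
  unfolding lamplighter_group_def elt_def semidirect_product_def
  using mod_carrier_iff[of f] by simp

lemma carrierE:
  assumes "x \<in> carrier G"
  obtains f k where "finite (supp f)" "x = elt f k"
proof -
  obtain f k where x: "x = (f, k)" by fastforce
  have range: "f i mod int p = f i" for i
    using assms p_gt_1 unfolding x lamplighter_group_def semidirect_product_def
    by (auto simp: carrier_sum_group carrier_integer_mod_group PiE_iff)
  then have "x = elt f k"
    by (simp add: x elt_def)
  with assms show thesis
    using elt_mem_carrier_iff that by blast
qed

lemma elt_mult: "elt f k \<otimes>\<^bsub>G\<^esub> elt g l = elt (\<lambda>i. f i + g (i - k)) (k + l)"
  by (simp add: lamplighter_group_def semidirect_product_def elt_def shift_def mod_add_eq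
      restrict_def)

lemma elt_one: "\<one>\<^bsub>G\<^esub> = elt (\<lambda>_. 0) 0"
  by (simp add: lamplighter_group_def semidirect_product_def elt_def restrict_def)

lemma elt_eq_iff: "elt f k = elt g l \<longleftrightarrow> k = l \<and> supp (\<lambda>i. f i - g i) = {}"
  by (auto simp: elt_def supp_def fun_eq_iff mod_eq_dvd_iff)

lemma elt_inv:
  assumes "finite (supp f)"
  shows "inv\<^bsub>G\<^esub> (elt f k) = elt (\<lambda>i. - f (i + k)) (- k)"
  using assms
  by (intro inv_equality) (simp_all add: elt_mult elt_one elt_mem_carrier_iff supp_shift_left
      supp_minus[of "\<lambda>i. f (i + k)"])

lemma elt_conj:
  assumes "finite (supp c)"
  shows "elt c k \<otimes>\<^bsub>G\<^esub> elt f l \<otimes>\<^bsub>G\<^esub> inv\<^bsub>G\<^esub> (elt c k) =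
    elt (\<lambda>i. c i + f (i - k) - c (i - l)) l"
  using assms by (simp add: elt_inv elt_mult algebra_simps)

lemma elt_mem_base_iff: "elt f k \<in> base S \<longleftrightarrow> k = 0 \<and> finite (supp f) \<and> supp f \<subseteq> S"
proof -
  have "supp f = supp g" if "supp (\<lambda>i. f i - g i) = {}" for g
    using that supp_add[of "\<lambda>i. f i - g i" g] supp_diff[of f "\<lambda>i. f i - g i"] by auto
  then show ?thesis
    by (auto simp: base_def elt_eq_iff intro!: exI[of _ f])
qed

lemma finite_base:
  assumes "finite S"
  shows "finite (base S)"
proof -
  let ?V = "{f. \<forall>i. (i \<in> S \<longrightarrow> f i \<in> {0..<int p}) \<and> (i \<notin> S \<longrightarrow> f i = 0)}"
  have "base S \<subseteq> ?V \<times> {0}"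
    using p_gt_1 by (auto simp: base_def elt_def supp_def subset_iff intro: dvd_imp_mod_0)
  moreover have "finite (?V \<times> {0::int})"
    using assms by (intro finite_cartesian_product finite_set_of_finite_funs) auto
  ultimately show ?thesis
    by (rule finite_subset)
qed

lemma subgroup_base: "subgroup (base S) G"
proof (rule subgroupI)
  show "base S \<subseteq> carrier G"
    by (auto simp: base_def elt_mem_carrier_iff)
  have "elt (\<lambda>_. 0) 0 \<in> base S"
    by (simp add: elt_mem_base_iff)
  then show "base S \<noteq> {}" by blast
next
  fix x assume "x \<in> base S"
  then show "inv\<^bsub>G\<^esub> x \<in> base S"
    by (auto simp: base_def[of S] elt_inv) (metis supp_minus)
next
  fix x y assume "x \<in> base S" "y \<in> base S"
  then obtain f g where fg: "x = elt f 0" "y = elt g 0" "finite (supp f)" "finite (supp g)"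
      "supp f \<subseteq> S" "supp g \<subseteq> S"
    by (auto simp: base_def)
  then have "finite (supp (\<lambda>i. f i + g i))" "supp (\<lambda>i. f i + g i) \<subseteq> S"
    using supp_add[of f g] by (auto intro: finite_subset)
  then show "x \<otimes>\<^bsub>G\<^esub> y \<in> base S"
    using fg by (simp add: elt_mult elt_mem_base_iff)
qed

lemma mem_baseE:
  assumes "x \<in> base S"
  obtains f where "x = elt f 0" "finite (supp f)" "supp f \<subseteq> S"
  using assms by (auto simp: base_def)

text \<open>
  Only finitely many elements of the base group are supported in a given window, and any finite set
  of elements is supported in some window. Hence within the base group almost containment means
  approximation up to an error of uniformly bounded support.
\<close>

lemma base_almost_containedI:
  assumes "H \<subseteq> base UNIV"
    and "\<And>f. elt f 0 \<in> H \<Longrightarrow> \<exists>g. elt g 0 \<in> L \<and> supp (\<lambda>i. f i - g i) \<subseteq> {-N..N}"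
  shows "almost_contained G H L"
proof (rule almost_containedI)
  show "finite (base {-N..N})" by (simp add: finite_base)
  show "base {-N..N} \<subseteq> carrier G" by (simp add: subgroup_base subgroup.subset)
next
  fix h assume h: "h \<in> H"
  then obtain f where f: "h = elt f 0"
    using assms(1) mem_baseE by blast
  then obtain g where g: "elt g 0 \<in> L" "supp (\<lambda>i. f i - g i) \<subseteq> {-N..N}"
    using assms(2) h by blast
  then have "elt (\<lambda>i. f i - g i) 0 \<in> base {-N..N}"
    by (auto simp: elt_mem_base_iff intro: finite_subset)
  moreover have "h = elt g 0 \<otimes>\<^bsub>G\<^esub> elt (\<lambda>i. f i - g i) 0"
    by (simp add: f elt_mult)
  ultimately show "\<exists>l\<in>L. \<exists>x\<in>base {-N..N}. h = l \<otimes>\<^bsub>G\<^esub> x"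
    using g(1) by blast
qed

lemma base_almost_containedE:
  assumes "almost_contained G H L" "L \<subseteq> base UNIV"
  obtains N where "N \<ge> 0"
    "\<And>f. elt f 0 \<in> H \<Longrightarrow> \<exists>g. elt g 0 \<in> L \<and> supp (\<lambda>i. f i - g i) \<subseteq> {-N..N}"
proof -
  obtain F where F: "finite F" "F \<subseteq> carrier G"
      "\<And>h. h \<in> H \<Longrightarrow> \<exists>l\<in>L. \<exists>x\<in>F. h = l \<otimes>\<^bsub>G\<^esub> x"
    using assms(1) by (rule almost_containedE) blast
  define T where "T = (\<Union>x\<in>F. supp (fst x))"
  have supp_elt: "supp (fst (elt f k)) = supp f" for f k
    by (simp add: elt_def supp_def dvd_mod_iff)
  have "finite (supp (fst x))" if "x \<in> F" for x
    using that F(2) by (metis carrierE subsetD supp_elt)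
  then have "finite T"
    using F(1) by (simp add: T_def)
  then obtain N where N: "N \<ge> 0" "T \<subseteq> {-N..N}"
    by (rule finite_int_subset_interval)
  have "\<exists>g. elt g 0 \<in> L \<and> supp (\<lambda>i. f i - g i) \<subseteq> {-N..N}" if "elt f 0 \<in> H" for f
  proof -
    obtain l x where lx: "l \<in> L" "x \<in> F" "elt f 0 = l \<otimes>\<^bsub>G\<^esub> x"
      using F(3) \<open>elt f 0 \<in> H\<close> by blast
    obtain g where g: "l = elt g 0"
      using assms(2) lx(1) mem_baseE by blast
    obtain e k where e: "x = elt e k"
      using F(2) lx(2) carrierE by blast
    have eq: "supp (\<lambda>i. f i - (g i + e i)) = {}"
      using lx(3) by (simp add: g e elt_mult elt_eq_iff)
    have "supp (\<lambda>i. f i - g i) \<subseteq> supp (\<lambda>i. f i - (g i + e i)) \<union> supp e"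
      using supp_add[of "\<lambda>i. f i - (g i + e i)" e] by (simp add: algebra_simps)
    also have "\<dots> \<subseteq> {-N..N}"
      using eq lx(2) N(2) supp_elt[of e k] by (auto simp: T_def e)
    finally show ?thesis
      using lx(1) g by blast
  qed
  then show thesis
    using N(1) that by blast
qed

section \<open>Inert subgroups of the base group\<close>

definition diff_closed :: "(int \<Rightarrow> int) set \<Rightarrow> bool"
  where "diff_closed W \<longleftrightarrow> (\<forall>f \<in> W. \<forall>g \<in> W. (\<lambda>i. f i - g i) \<in> W)"

lemma diff_closedD: "diff_closed W \<Longrightarrow> f \<in> W \<Longrightarrow> g \<in> W \<Longrightarrow> (\<lambda>i. f i - g i) \<in> W"
  by (simp add: diff_closed_def)

lemma diff_closed_cmult:
  assumes "diff_closed W" "f \<in> W"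
  shows "(\<lambda>i. c * f i) \<in> W"
proof (induction c rule: int_induct[where k = 0])
  case base
  then show ?case using diff_closedD[OF assms(1,2,2)] by simp
next
  case (step1 c)
  have "(\<lambda>i. 0 - f i) \<in> W"
    using diff_closedD[OF assms(1) diff_closedD[OF assms(1,2,2)] assms(2)] by simp
  from diff_closedD[OF assms(1) step1(2) this] show ?case
    by (simp add: algebra_simps)
next
  case (step2 c)
  from diff_closedD[OF assms(1) step2(2) assms(2)] show ?case
    by (simp add: algebra_simps)
qed

lemma diff_closed_add:
  assumes "diff_closed W" "f \<in> W" "g \<in> W"
  shows "(\<lambda>i. f i + g i) \<in> W"
  using diff_closedD[OF assms(1,2) diff_closed_cmult[OF assms(1,3), of "-1"]] by simp

text \<open>
  Division with remainder: as \<open>p\<close> is prime, a multiple of the element of \<open>W\<close> with top degree \<open>d\<close>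
  cancels the coefficient of \<open>f\<close> at \<open>d\<close>, and the lower bound \<open>a\<close> is common to all these elements.
\<close>

lemma reduce_top:
  assumes diff: "diff_closed W"
    and top: "\<And>d. d > D \<Longrightarrow> \<exists>w \<in> W. supp w \<subseteq> {a..d} \<and> d \<in> supp w"
    and "w0 \<in> W"
    and "supp f \<subseteq> {a..D + int n}"
  shows "\<exists>g \<in> W. supp (\<lambda>i. f i - g i) \<subseteq> {a..D}"
  using assms(4)
proof (induction n arbitrary: f)
  case 0
  then show ?case
    using diff_closedD[OF diff assms(3,3)] by (intro bexI[of _ "\<lambda>_. 0"]) auto
next
  case (Suc n)
  define d where "d = D + int (Suc n)"
  have d: "d > D" by (simp add: d_def)
  obtain w where w: "w \<in> W" "supp w \<subseteq> {a..d}" "d \<in> supp w"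
    using top[OF d] by blast
  have "coprime (w d) (int p)"
    using w(3) prime by (simp add: mem_supp_iff coprime_commute prime_imp_coprime)
  then obtain u v where uv: "u * w d + v * int p = 1"
    using bezout_int[of "w d" "int p"] by (auto simp: coprime_iff_gcd_eq_1)
  define c where "c = u * f d"
  have "f d - c * w d = f d * (u * w d + v * int p) - c * w d"
    by (simp add: uv)
  also have "\<dots> = int p * (v * f d)"
    by (simp add: c_def algebra_simps)
  finally have c: "int p dvd f d - c * w d"
    by simp
  have "supp (\<lambda>i. f i - c * w i) \<subseteq> supp f \<union> supp w - {d}"
    using c by (auto simp: supp_def)
  also have "\<dots> \<subseteq> {a..D + int n}"
    using w(2) Suc.prems by (force simp: d_def)
  finally obtain g where g: "g \<in> W" "supp (\<lambda>i. f i - c * w i - g i) \<subseteq> {a..D}"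
    using Suc.IH[of "\<lambda>i. f i - c * w i"] by auto
  have "(\<lambda>i. c * w i + g i) \<in> W"
    using diff_closed_cmult[OF diff w(1)] g(1) by (intro diff_closed_add[OF diff])
  then show ?case
    using g(2) by (intro bexI[of _ "\<lambda>i. c * w i + g i"]) (simp_all add: algebra_simps)
qed

text \<open>
  The error made by one shift has degree at most \<open>m\<close>, so it cannot cancel a top term of degree above
  \<open>m\<close>. Once there is such a term, repeated shifting produces elements of all larger degrees, with
  lowest terms that eventually stay at or above \<open>-m\<close>.
\<close>

lemma half_line_dichotomy:
  assumes diff: "diff_closed W"
    and fin: "\<And>f. f \<in> W \<Longrightarrow> finite (supp f)"
    and shift: "\<And>f. f \<in> W \<Longrightarrow>
      \<exists>g. supp (\<lambda>i. f i - g i) \<subseteq> {-m..m} \<and> (\<lambda>i. g (i - 1)) \<in> W"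
    and m: "m \<ge> 0"
  shows "(\<forall>f \<in> W. supp f \<subseteq> {..m}) \<or>
    (\<exists>N \<ge> 0. \<forall>f. finite (supp f) \<longrightarrow> supp f \<subseteq> {0..} \<longrightarrow>
      (\<exists>g \<in> W. supp (\<lambda>i. f i - g i) \<subseteq> {-N..N}))"
proof (rule disjCI)
  assume "\<not> (\<exists>N \<ge> 0. \<forall>f. finite (supp f) \<longrightarrow> supp f \<subseteq> {0..} \<longrightarrow>
      (\<exists>g \<in> W. supp (\<lambda>i. f i - g i) \<subseteq> {-N..N}))"
  then have no_N: False if "N \<ge> 0" "\<And>f. finite (supp f) \<Longrightarrow> supp f \<subseteq> {0..} \<Longrightarrow>
      \<exists>g \<in> W. supp (\<lambda>i. f i - g i) \<subseteq> {-N..N}" for N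
    using that by blast
  show "\<forall>f \<in> W. supp f \<subseteq> {..m}"
  proof (rule ccontr)
    assume "\<not> (\<forall>f \<in> W. supp f \<subseteq> {..m})"
    then obtain v where v: "v \<in> W" "\<not> supp v \<subseteq> {..m}" by blast
    define b where "b = Max (supp v)"
    define a where "a = Min (supp v)"
    have ne: "supp v \<noteq> {}" and fin_v: "finite (supp v)"
      using v fin by auto
    then have b: "b \<in> supp v" "b > m"
      using v(2) by (auto simp: b_def Max_gr_iff not_le)
    have vab: "supp v \<subseteq> {a..b}"
      using fin_v by (auto simp: a_def b_def)
    \<comment> \<open>After each correction the lowest term is at least the minimum of the old one and -m; the shift then adds 1.\<close>
    have chain: "\<exists>w \<in> W. supp w \<subseteq> {min (a + int j) (- m)..b + int j} \<and> b + int j \<in> supp w" for j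
    proof (induction j)
      case 0
      have "supp v \<subseteq> {min a (- m)..b}"
        by (rule order_trans[OF vab]) simp
      then show ?case
        using v(1) b(1) by auto
    next
      case (Suc j)
      then obtain w where w: "w \<in> W" "supp w \<subseteq> {min (a + int j) (- m)..b + int j}"
          "b + int j \<in> supp w"
        by blast
      obtain g where g: "supp (\<lambda>i. w i - g i) \<subseteq> {-m..m}" "(\<lambda>i. g (i - 1)) \<in> W"
        using shift[OF w(1)] by blast
      have "supp g \<subseteq> supp w \<union> supp (\<lambda>i. w i - g i)"
        using supp_diff[of w "\<lambda>i. w i - g i"] by simp
      also have "\<dots> \<subseteq> {min (a + int j) (- m)..b + int j}"
        using w(2) g(1) b(2) by force
      finally have "supp (\<lambda>i. g (i - 1)) \<subseteq> {min (a + int (Suc j)) (- m)..b + int (Suc j)}"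
        unfolding supp_shift_right by force
      moreover have "b + int (Suc j) \<in> supp (\<lambda>i. g (i - 1))"
      proof -
        have "b + int j \<notin> supp (\<lambda>i. w i - g i)"
          using g(1) b(2) by auto
        then have "b + int j \<in> supp g"
          using w(3) by (auto simp: mem_supp_iff) (metis diff_add_cancel dvd_add)
        then show ?thesis
          unfolding supp_shift_right by force
      qed
      ultimately show ?case
        using g(2) by blast
    qed
    define j0 where "j0 = nat (- m - a)"
    define D where "D = b + int j0"
    have top: "\<exists>w \<in> W. supp w \<subseteq> {- m..d} \<and> d \<in> supp w" if "d > D" for d
    proof -
      define j where "j = nat (d - b)"
      have "b \<le> d" "a + (d - b) \<ge> - m"
        using that unfolding D_def j0_def by linarith+
      then have "b + int j = d" "min (a + int j) (- m) = - m"
        by (simp_all add: j_def)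
      then show ?thesis using chain[of j] by simp
    qed
    have D: "D \<ge> 0" using b(2) m by (simp add: D_def)
    show False
    proof (rule no_N)
      show "max m D \<ge> 0" using m by simp
      fix f assume f: "finite (supp f)" "supp f \<subseteq> {0..}"
      obtain n where n: "supp f \<subseteq> {-n..n}" "n \<ge> 0"
        using finite_int_subset_interval[OF f(1)] by blast
      have "supp f \<subseteq> {-m..D + int (nat n)}"
        using n f(2) D m by force
      from reduce_top[OF diff top v(1) this]
      obtain g where "g \<in> W" "supp (\<lambda>i. f i - g i) \<subseteq> {-m..D}" by blast
      moreover have "{-m..D} \<subseteq> {-max m D..max m D}" by auto
      ultimately show "\<exists>g\<in>W. supp (\<lambda>i. f i - g i) \<subseteq> {-max m D..max m D}"
        by blast
    qed
  qed
qed

lemma fiber_diff: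
  assumes "subgroup H G" "elt f 0 \<in> H" "elt g 0 \<in> H"
  shows "elt (\<lambda>i. f i - g i) 0 \<in> H"
proof -
  interpret H: subgroup H G by fact
  have "elt g 0 \<in> carrier G"
    using assms(3) by simp
  then have "elt f 0 \<otimes>\<^bsub>G\<^esub> inv\<^bsub>G\<^esub> (elt g 0) = elt (\<lambda>i. f i - g i) 0"
    by (simp add: elt_mem_carrier_iff elt_inv elt_mult)
  then show ?thesis
    using assms by (metis H.m_closed H.m_inv_closed)
qed

text \<open>
  Conjugation by the \<open>k\<close>-th power of the generator of the acting group \<open>\<int>\<close> shifts the base group, so
  this is inertness read in coordinates.
\<close>

lemma inert_shift:
  assumes "inert_subgroup H G" "H \<subseteq> base UNIV"
  obtains m where "m \<ge> 0"
    "\<And>f. elt f 0 \<in> H \<Longrightarrow> \<exists>g. elt (\<lambda>i. g (i - k)) 0 \<in> H \<and> supp (\<lambda>i. f i - g i) \<subseteq> {-m..m}"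
proof -
  have H: "subgroup H G" "H \<subseteq> carrier G"
    using assms(1) by (auto simp: inert_subgroup_iff subgroup.subset)
  define t where "t = elt (\<lambda>_. 0) k"
  have t: "t \<in> carrier G"
    by (simp add: t_def elt_mem_carrier_iff)
  have conj: "t \<otimes>\<^bsub>G\<^esub> elt f l \<otimes>\<^bsub>G\<^esub> inv\<^bsub>G\<^esub> t = elt (\<lambda>i. f (i - k)) l" for f l
    by (simp add: t_def elt_conj)
  have "almost_contained G H (conjugate_subgroup G H t)"
    using assms(1) t by (simp add: inert_subgroup_iff)
  moreover have "conjugate_subgroup G H t \<subseteq> base UNIV"
  proof
    fix x assume "x \<in> conjugate_subgroup G H t"
    then have x: "x \<in> carrier G" "t \<otimes>\<^bsub>G\<^esub> x \<otimes>\<^bsub>G\<^esub> inv\<^bsub>G\<^esub> t \<in> base UNIV"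
      using assms(2) by (auto simp: mem_conjugate_subgroup_iff[OF H(2) t])
    from x(1) obtain f l where "finite (supp f)" "x = elt f l"
      by (rule carrierE)
    with x(2) show "x \<in> base UNIV"
      by (simp add: conj elt_mem_base_iff)
  qed
  ultimately obtain m where m: "m \<ge> 0" "\<And>f. elt f 0 \<in> H \<Longrightarrow>
      \<exists>g. elt g 0 \<in> conjugate_subgroup G H t \<and> supp (\<lambda>i. f i - g i) \<subseteq> {-m..m}"
    by (rule base_almost_containedE) blast
  show thesis
    by (rule that[OF m(1)])
      (use m(2) in \<open>auto simp: mem_conjugate_subgroup_iff[OF H(2) t] conj\<close>)
qed

lemma almost_contained_baseI:
  assumes "H \<subseteq> base UNIV" "\<And>f. elt f 0 \<in> H \<Longrightarrow> supp f \<subseteq> S \<union> {-N..N}"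
  shows "almost_contained G H (base S)"
proof (rule base_almost_containedI[OF assms(1)])
  fix f assume f: "elt f 0 \<in> H"
  let ?g = "\<lambda>i. if i \<in> S then f i else 0"
  have "supp ?g = supp f \<inter> S" "supp (\<lambda>i. f i - ?g i) = supp f - S"
    by (auto simp: supp_def)
  moreover have "finite (supp f)"
    using f assms(1) by (auto simp: elt_mem_base_iff)
  ultimately show "\<exists>g. elt g 0 \<in> base S \<and> supp (\<lambda>i. f i - g i) \<subseteq> {-N..N}"
    using assms(2)[OF f] by (intro exI[of _ ?g]) (auto simp: elt_mem_base_iff)
qed

text \<open>
  The dichotomy is applied to \<open>H\<close> and to its image under the reflection \<open>i \<mapsto> - i\<close>.
\<close>

lemma inert_subgroup_of_base:
  assumes "inert_subgroup H G" "H \<subseteq> base UNIV"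
  shows "\<exists>S \<in> {{}, {0..}, {..0}, UNIV}.
    almost_contained G H (base S) \<and> almost_contained G (base S) H"
proof -
  have H: "subgroup H G"
    using assms(1) by (simp add: inert_subgroup_iff)
  define W where "W = {f. elt f 0 \<in> H}"
  define W' where "W' = {f. (\<lambda>i. f (- i)) \<in> W}"
  have mem_W: "f \<in> W \<longleftrightarrow> elt f 0 \<in> H" for f
    by (simp add: W_def)
  have diff: "diff_closed W"
    using fiber_diff[OF H] by (simp add: W_def diff_closed_def)
  have fin: "finite (supp f)" if "f \<in> W" for f
    using that assms(2) by (auto simp: W_def elt_mem_base_iff)
  obtain m where m: "m \<ge> 0"
    "\<And>f. f \<in> W \<Longrightarrow> \<exists>g. (\<lambda>i. g (i - 1)) \<in> W \<and> supp (\<lambda>i. f i - g i) \<subseteq> {-m..m}"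
    using inert_shift[OF assms, of 1] unfolding W_def by simp blast
  obtain m' where m': "m' \<ge> 0"
    "\<And>f. f \<in> W \<Longrightarrow> \<exists>g. (\<lambda>i. g (i + 1)) \<in> W \<and> supp (\<lambda>i. f i - g i) \<subseteq> {-m'..m'}"
    using inert_shift[OF assms, of "-1"] unfolding W_def by simp blast
  have up: "(\<forall>f \<in> W. supp f \<subseteq> {..m}) \<or> (\<exists>N \<ge> 0. \<forall>f. finite (supp f) \<longrightarrow> supp f \<subseteq> {0..} \<longrightarrow>
      (\<exists>g \<in> W. supp (\<lambda>i. f i - g i) \<subseteq> {-N..N}))"
    by (rule half_line_dichotomy) (use diff fin m in blast)+
  have "(\<forall>f \<in> W'. supp f \<subseteq> {..m'}) \<or> (\<exists>N \<ge> 0. \<forall>f. finite (supp f) \<longrightarrow> supp f \<subseteq> {0..} \<longrightarrow>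
      (\<exists>g \<in> W'. supp (\<lambda>i. f i - g i) \<subseteq> {-N..N}))"
  proof (rule half_line_dichotomy)
    fix f assume f: "f \<in> W'"
    show "finite (supp f)"
      using f fin[of "\<lambda>i. f (- i)"] by (simp add: W'_def supp_reflect finite_image_iff)
    obtain g where g: "(\<lambda>i. g (i + 1)) \<in> W" "supp (\<lambda>i. f (- i) - g i) \<subseteq> {-m'..m'}"
      using f m'(2) by (auto simp: W'_def)
    have "supp (\<lambda>i. f i - g (- i)) \<subseteq> {-m'..m'}"
      using g(2) supp_reflect[of "\<lambda>i. f (- i) - g i"] by auto
    then show "\<exists>g. supp (\<lambda>i. f i - g i) \<subseteq> {-m'..m'} \<and> (\<lambda>i. g (i - 1)) \<in> W'"
      using g(1) by (intro exI[of _ "\<lambda>i. g (- i)"]) (simp add: W'_def add.commute)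
  qed (use diff m'(1) in \<open>auto simp: W'_def diff_closed_def\<close>)
  then have down: "(\<forall>f \<in> W. supp f \<subseteq> {-m'..}) \<or>
      (\<exists>N \<ge> 0. \<forall>f. finite (supp f) \<longrightarrow> supp f \<subseteq> {..0} \<longrightarrow>
        (\<exists>g \<in> W. supp (\<lambda>i. f i - g i) \<subseteq> {-N..N}))"
  proof (elim disjE exE conjE, goal_cases)
    case 1
    have "supp f \<subseteq> {-m'..}" if "f \<in> W" for f
    proof -
      have "supp (\<lambda>i. f (- i)) \<subseteq> {..m'}"
        using 1 that by (auto simp: W'_def)
      then show ?thesis by (force simp: supp_reflect)
    qed
    then show ?case by blast
  next
    case (2 N)
    have "\<exists>g \<in> W. supp (\<lambda>i. f i - g i) \<subseteq> {-N..N}"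
      if "finite (supp f)" "supp f \<subseteq> {..0}" for f
    proof -
      have "finite (supp (\<lambda>i. f (- i)))" "supp (\<lambda>i. f (- i)) \<subseteq> {0..}"
        using that by (auto simp: supp_reflect)
      then obtain g where g: "g \<in> W'" "supp (\<lambda>i. f (- i) - g i) \<subseteq> {-N..N}"
        using 2(2) by meson
      have "supp (\<lambda>i. f i - g (- i)) \<subseteq> {-N..N}"
        using g(2) supp_reflect[of "\<lambda>i. f (- i) - g i"] by auto
      then show ?thesis
        using g(1) by (intro bexI[of _ "\<lambda>i. g (- i)"]) (simp_all add: W'_def)
    qed
    then show ?case using 2(1) by blast
  qed
  have containsI: "almost_contained G (base S) H"
    if "\<And>f. finite (supp f) \<Longrightarrow> supp f \<subseteq> S \<Longrightarrow> \<exists>g \<in> W. supp (\<lambda>i. f i - g i) \<subseteq> {-N..N}" for S N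
  proof (rule base_almost_containedI)
    show "base S \<subseteq> base UNIV" by (auto simp: base_def)
    fix f assume "elt f 0 \<in> base S"
    then show "\<exists>g. elt g 0 \<in> H \<and> supp (\<lambda>i. f i - g i) \<subseteq> {-N..N}"
      using that[of f] by (auto simp: elt_mem_base_iff W_def)
  qed
  have trivial: "\<exists>g \<in> W. supp (\<lambda>i. f i - g i) \<subseteq> {-0..0}" if "supp f \<subseteq> {}" for f
  proof -
    have "\<one>\<^bsub>G\<^esub> \<in> H" using H by (rule subgroup.one_closed)
    then show ?thesis
      using that by (intro bexI[of _ "\<lambda>_. 0"]) (simp_all add: W_def elt_one)
  qed
  note containedI = almost_contained_baseI[OF assms(2), folded mem_W]
  from up down show ?thesis
  proof (elim disjE exE conjE, goal_cases)
    case 1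
    have "almost_contained G H (base {})"
      by (rule containedI[of _ "max m m'"]) (use 1 in force)
    then show ?case using containsI[OF trivial] by blast
  next
    case (2 N)
    have "almost_contained G H (base {..0})"
      by (rule containedI[of _ m]) (use 2(1) in force)
    moreover have "almost_contained G (base {..0}) H"
      by (rule containsI[of _ N]) (use 2 in blast)
    ultimately show ?case by blast
  next
    case (3 N)
    have "almost_contained G H (base {0..})"
      by (rule containedI[of _ m']) (use 3(1) in force)
    moreover have "almost_contained G (base {0..}) H"
      by (rule containsI[of _ N]) (use 3 in blast)
    ultimately show ?case by blast
  next
    case (4 N N')
    have "almost_contained G H (base UNIV)"
      by (rule containedI[of _ 0]) simp
    moreover have "almost_contained G (base UNIV) H"
    proof (rule containsI[of _ "max N N'"])
      fix f assume f: "finite (supp f)"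
      define f1 where "f1 = (\<lambda>i. if i \<ge> 0 then f i else 0)"
      define f2 where "f2 = (\<lambda>i. if i \<ge> 0 then 0 else f i)"
      have "supp f1 \<subseteq> supp f \<inter> {0..}" "supp f2 \<subseteq> supp f \<inter> {..0}"
        by (auto simp: supp_def f1_def f2_def)
      then have "finite (supp f1)" "supp f1 \<subseteq> {0..}" "finite (supp f2)" "supp f2 \<subseteq> {..0}"
        using f by (auto intro: finite_subset)
      then obtain g1 g2 where g: "g1 \<in> W" "supp (\<lambda>i. f1 i - g1 i) \<subseteq> {-N..N}"
          "g2 \<in> W" "supp (\<lambda>i. f2 i - g2 i) \<subseteq> {-N'..N'}"
        using 4 by meson
      have "(\<lambda>i. f i - (g1 i + g2 i)) = (\<lambda>i. (f1 i - g1 i) + (f2 i - g2 i))"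
        by (auto simp: f1_def f2_def)
      then have "supp (\<lambda>i. f i - (g1 i + g2 i)) \<subseteq>
          supp (\<lambda>i. f1 i - g1 i) \<union> supp (\<lambda>i. f2 i - g2 i)"
        using supp_add by simp
      also have "\<dots> \<subseteq> {-max N N'..max N N'}"
        using g(2,4) by force
      finally show "\<exists>g \<in> W. supp (\<lambda>i. f i - g i) \<subseteq> {-max N N'..max N N'}"
        using diff_closed_add[OF diff g(1,3)] by (intro bexI[of _ "\<lambda>i. g1 i + g2 i"])
    qed
    ultimately show ?case by blast
  qed
qed

section \<open>Inert subgroups outside the base group\<close>

lemma snd_mult: "snd (x \<otimes>\<^bsub>G\<^esub> y) = snd x + snd y"
  by (simp add: lamplighter_group_def semidirect_product_def split: prod.split)

lemma snd_pow: "snd (x [^]\<^bsub>G\<^esub> (n :: nat)) = int n * snd x"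
  by (induction n) (simp_all add: snd_mult elt_one elt_def algebra_simps)

lemma snd_inv:
  assumes "x \<in> carrier G"
  shows "snd (inv\<^bsub>G\<^esub> x) = - snd x"
proof -
  have "snd x + snd (inv\<^bsub>G\<^esub> x) = snd \<one>\<^bsub>G\<^esub>"
    using assms by (simp flip: snd_mult)
  then show ?thesis by (simp add: elt_one elt_def)
qed

lemma snd_elt [simp]: "snd (elt f k) = k"
  by (simp add: elt_def)

end

text \<open>
  If \<open>n\<close> is a period for \<open>r\<close>, shifting by multiples of \<open>k\<close> makes it a period for all of \<open>r + k\<int>\<close>. So
  one choice of period for each residue modulo \<open>k\<close> suffices, and \<open>D\<close> is the largest \<open>k n\<close> that
  arises.
\<close>

lemma periodic_equivalence_bounded:
  fixes R :: "int \<Rightarrow> int \<Rightarrow> bool"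
  assumes "equivp R" and "k > 0"
    and shift: "\<And>i j. R i j \<longleftrightarrow> R (i + k) (j + k)"
    and per: "\<And>i. \<exists>n > 0. R i (i + k * n)"
  shows "\<exists>D \<ge> 0. \<forall>i. \<exists>j \<in> {0..<D}. R i j"
proof -
  have shift_mult: "R i j \<longleftrightarrow> R (i + k * q) (j + k * q)" for i j q
  proof (induction q rule: int_induct[where k = 0])
    case (step1 q)
    then show ?case
      using shift[of "i + k * q" "j + k * q"] by (simp add: algebra_simps)
  next
    case (step2 q)
    then show ?case
      using shift[of "i + k * (q - 1)" "j + k * (q - 1)"] by (simp add: algebra_simps)
  qed simp
  have iterate: "R i (i + k * (n * q))" if "R i (i + k * n)" for i n q
  proof (induction q rule: int_induct[where k = 0])
    case base
    then show ?case using assms(1) by (simp add: equivp_reflp)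
  next
    case (step1 q)
    have "R (i + k * (n * q)) (i + k * (n * (q + 1)))"
      using that shift_mult[of i "i + k * n" "n * q"] by (simp add: algebra_simps)
    with step1(2) show ?case by (rule equivp_transp[OF assms(1)])
  next
    case (step2 q)
    have "R (i + k * (n * (q - 1))) (i + k * (n * q))"
      using that shift_mult[of i "i + k * n" "n * (q - 1)"] by (simp add: algebra_simps)
    with step2(2) show ?case
      using equivp_transp[OF assms(1)] equivp_symp[OF assms(1)] by blast
  qed
  obtain n where n: "\<And>i. n i > 0" "\<And>i. R i (i + k * n i)"
    using per by metis
  define D where "D = Max ((\<lambda>r. k * n r) ` {0..<k})"
  have D: "k * n r \<le> D" if "r \<in> {0..<k}" for r
    unfolding D_def using that by (intro Max_ge) auto
  have "\<exists>j \<in> {0..<D}. R i j" for i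
  proof -
    define r q where "r = i mod k" and "q = i div k"
    define s where "s = q mod n r"
    have r: "r \<in> {0..<k}"
      using \<open>k > 0\<close> by (simp add: r_def)
    have s: "0 \<le> s" "s \<le> n r - 1"
      using n(1)[of r] by (simp_all add: s_def)
    have "R r (r + k * (n r * (q div n r)))"
      by (rule iterate) (rule n(2))
    then have "R (r + k * s) (r + k * (n r * (q div n r)) + k * s)"
      using shift_mult by blast
    moreover have "r + k * (n r * (q div n r)) + k * s = r + k * q"
      by (simp add: s_def add.assoc flip: distrib_left)
    moreover have "r + k * q = i"
      by (simp add: r_def q_def)
    ultimately have "R i (r + k * s)"
      using equivp_symp[OF assms(1)] by simp
    moreover have "k * s \<le> k * (n r - 1)"
      using s(2) \<open>k > 0\<close> by (intro mult_left_mono) auto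
    then have "r + k * s \<in> {0..<D}"
      using r s(1) \<open>k > 0\<close> D[OF r] by (auto simp: algebra_simps)
    ultimately show ?thesis by blast
  qed
  moreover have "D \<ge> 0"
    using D[of 0] n(1)[of 0] \<open>k > 0\<close> by (smt (verit) atLeastLessThan_iff mult_pos_pos)
  ultimately show ?thesis by blast
qed

context lamplighter
begin

definition delta :: "int \<Rightarrow> int \<Rightarrow> int"
  where "delta i = (\<lambda>x. if x = i then 1 else 0)"

lemma supp_delta [simp]: "supp (delta i) = {i}"
  using p_gt_1 by (auto simp: supp_def delta_def)

text \<open>
  If \<open>h^n\<close> lies in the conjugate of \<open>H\<close> by \<open>c\<close>, then \<open>H\<close> contains both \<open>h^n\<close> and \<open>c h^n c^(-1)\<close>.
  These have the same image in \<open>\<int>\<close>, and their quotient is the stated element.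
\<close>

lemma inert_subgroup_torsion:
  assumes "inert_subgroup H G" "h \<in> H" "finite (supp c)"
  obtains n where "n > 0" "elt (\<lambda>i. c i - c (i - snd h * n)) 0 \<in> H"
proof -
  have H: "subgroup H G" "H \<subseteq> carrier G"
    using assms(1) by (auto simp: inert_subgroup_iff subgroup.subset)
  interpret H: subgroup H G by fact
  have c: "elt c 0 \<in> carrier G"
    using assms(3) by (simp add: elt_mem_carrier_iff)
  have "almost_contained G H (conjugate_subgroup G H (elt c 0))"
    using assms(1) c by (simp add: inert_subgroup_iff)
  then obtain n :: nat where n: "n > 0" "h [^]\<^bsub>G\<^esub> n \<in> conjugate_subgroup G H (elt c 0)"
    using almost_contained_imp_power_mem H(1) subgroup_conjugate_subgroup[OF H(1) c] assms(2)
    by blast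
  have pow_mem: "h [^]\<^bsub>G\<^esub> n \<in> H"
    using assms(2) by (induction n) auto
  then obtain f l where fl: "finite (supp f)" "h [^]\<^bsub>G\<^esub> n = elt f l"
    using carrierE H(2) by blast
  then have l: "l = snd h * int n"
    using snd_pow[of h n] by (simp add: mult.commute)
  have "elt (\<lambda>i. c i + f i - c (i - l)) l \<in> H"
    using n(2) elt_conj[OF assms(3), of 0 f l]
    by (simp add: mem_conjugate_subgroup_iff[OF H(2) c] fl)
  then have "elt (\<lambda>i. c i + f i - c (i - l)) l \<otimes>\<^bsub>G\<^esub> inv\<^bsub>G\<^esub> (elt f l) \<in> H"
    using pow_mem unfolding fl(2) by blast
  then have "elt (\<lambda>i. c i - c (i - l)) 0 \<in> H"
    by (simp add: elt_inv fl(1) elt_mult)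
  then show thesis
    using n(1) by (intro that[of "int n"]) (simp_all add: l)
qed

text \<open>
  Modulo the part of \<open>H\<close> in the base group, monomials \<open>delta i\<close> have finitely many classes, with
  representatives in \<open>{0..<D}\<close>; replacing each monomial of \<open>f\<close> by its representative moves the
  support of \<open>f\<close> into this window.
\<close>

lemma inert_subgroup_almost_contains_base:
  assumes "inert_subgroup H G" "h \<in> H" "snd h > 0"
  shows "almost_contained G (base UNIV) H"
proof -
  have H: "subgroup H G" "H \<subseteq> carrier G"
    using assms(1) by (auto simp: inert_subgroup_iff subgroup.subset)
  interpret H: subgroup H G by fact
  define k where "k = snd h"
  obtain b where b: "finite (supp b)" "h = elt b k"
    using assms(2) H(2) carrierE by (metis k_def snd_elt subsetD)
  define W where "W = {f. elt f 0 \<in> H}"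
  have diff: "diff_closed W"
    using fiber_diff[OF H(1)] by (simp add: W_def diff_closed_def)
  have zero: "(\<lambda>_. 0) \<in> W"
    using H.one_closed by (simp add: W_def elt_one)
  have shift_right: "(\<lambda>i. f (i - k)) \<in> W" if "f \<in> W" for f
  proof -
    have "elt b k \<otimes>\<^bsub>G\<^esub> elt f 0 \<otimes>\<^bsub>G\<^esub> inv\<^bsub>G\<^esub> (elt b k) \<in> H"
      using that assms(2) unfolding b(2) W_def by blast
    then show ?thesis
      by (simp add: elt_conj[OF b(1)] W_def)
  qed
  have shift_left: "(\<lambda>i. f (i + k)) \<in> W" if "f \<in> W" for f
  proof -
    have "inv\<^bsub>G\<^esub> (elt b k) \<otimes>\<^bsub>G\<^esub> elt f 0 \<otimes>\<^bsub>G\<^esub> elt b k \<in> H"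
      using that assms(2) unfolding b(2) W_def by blast
    then show ?thesis
      using b(1) by (simp add: elt_inv elt_mult W_def)
  qed
  define R where "R = (\<lambda>i j. (\<lambda>x. delta i x - delta j x) \<in> W)"
  have "\<exists>D \<ge> 0. \<forall>i. \<exists>j \<in> {0..<D}. R i j"
  proof (rule periodic_equivalence_bounded)
    show "k > 0" using assms(3) by (simp add: k_def)
    show "equivp R"
    proof (rule equivpI)
      show "reflp R"
        using zero by (simp add: R_def reflp_def)
      show "symp R"
      proof (rule sympI)
        fix i j assume "R i j"
        then show "R j i"
          using diff_closedD[OF diff zero] by (fastforce simp: R_def)
      qed
      show "transp R"
      proof (rule transpI)
        fix i j l assume "R i j" "R j l"
        then show "R i l"
          using diff_closed_add[OF diff] by (fastforce simp: R_def)
      qed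
    qed
  next
    fix i j
    have delta_right: "delta l (x - k) = delta (l + k) x" and
         delta_left: "delta (l + k) (x + k) = delta l x" for l x
      by (auto simp: delta_def)
    show "R i j \<longleftrightarrow> R (i + k) (j + k)"
      using shift_right[of "\<lambda>x. delta i x - delta j x"]
        shift_left[of "\<lambda>x. delta (i + k) x - delta (j + k) x"]
      by (auto simp: R_def delta_right delta_left)
  next
    fix i
    have delta_eq: "delta i (x - k * n) = delta (i + k * n) x" for x n
      by (auto simp: delta_def)
    have "finite (supp (delta i))" by simp
    then obtain n where "n > 0" "elt (\<lambda>x. delta i x - delta i (x - snd h * n)) 0 \<in> H"
      by (rule inert_subgroup_torsion[OF assms(1,2)])
    then show "\<exists>n > 0. R i (i + k * n)"
      by (auto simp: R_def W_def delta_eq simp flip: k_def)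
  qed
  then obtain D where D: "D \<ge> 0" "\<And>i. \<exists>j \<in> {0..<D}. R i j" by blast
  have approx: "\<exists>g \<in> W. supp (\<lambda>x. f x - g x) \<subseteq> {0..<D}"
    if "finite T" "supp f \<subseteq> T \<union> {0..<D}" for f T
    using that
  proof (induction T arbitrary: f rule: finite_induct)
    case empty
    then show ?case using zero by (intro bexI[of _ "\<lambda>_. 0"]) auto
  next
    case (insert i T)
    obtain j where j: "j \<in> {0..<D}" "R i j"
      using D(2) by blast
    define u where "u = (\<lambda>x. f i * (delta i x - delta j x))"
    have u: "u \<in> W"
      unfolding u_def using j(2) by (intro diff_closed_cmult[OF diff]) (simp add: R_def)
    have "supp (\<lambda>x. f x - u x) \<subseteq> T \<union> {0..<D}"
    proof
      fix x assume "x \<in> supp (\<lambda>x. f x - u x)"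
      then show "x \<in> T \<union> {0..<D}"
        using insert.prems j(1) by (cases "x = i"; cases "x = j")
          (auto simp: u_def delta_def supp_def)
    qed
    then obtain g where g: "g \<in> W" "supp (\<lambda>x. f x - u x - g x) \<subseteq> {0..<D}"
      using insert.IH by blast
    show ?case
      using g(2) diff_closed_add[OF diff u g(1)]
      by (intro bexI[of _ "\<lambda>x. u x + g x"]) (simp_all add: algebra_simps)
  qed
  show ?thesis
  proof (rule base_almost_containedI)
    fix f assume "elt f 0 \<in> base UNIV"
    then have "finite (supp f)" by (simp add: elt_mem_base_iff)
    then obtain g where "g \<in> W" "supp (\<lambda>x. f x - g x) \<subseteq> {0..<D}"
      using approx[of "supp f" f] by blast
    moreover have "{0..<D} \<subseteq> {-D..D}"
      using D(1) by auto
    ultimately show "\<exists>g. elt g 0 \<in> H \<and> supp (\<lambda>i. f i - g i) \<subseteq> {-D..D}"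
      unfolding W_def by blast
  qed simp
qed

text \<open>
  If \<open>h \<in> H\<close> maps to \<open>k > 0\<close> in \<open>\<int>\<close>, then \<open>H\<close> meets the fibre over every multiple of \<open>k\<close>. So an
  arbitrary element can be moved by \<open>H\<close> into one of the fibres over \<open>{0..<k}\<close>, each of which is a
  translate of the base group.
\<close>

lemma inert_subgroup_not_in_base:
  assumes "inert_subgroup H G" "\<not> H \<subseteq> base UNIV"
  shows "almost_contained G (carrier G) H"
proof -
  have H: "subgroup H G" "H \<subseteq> carrier G"
    using assms(1) by (auto simp: inert_subgroup_iff subgroup.subset)
  interpret H: subgroup H G by fact
  obtain h0 where h0: "h0 \<in> H" "h0 \<notin> base UNIV"
    using assms(2) by blast
  obtain f0 k0 where fk: "finite (supp f0)" "h0 = elt f0 k0"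
    using h0(1) H(2) carrierE by blast
  have "snd h0 \<noteq> 0"
    using h0(2) fk by (simp add: elt_mem_base_iff)
  moreover have "snd (inv\<^bsub>G\<^esub> h0) = - snd h0"
    using h0(1) by (simp add: snd_inv)
  ultimately obtain h where h: "h \<in> H" "snd h > 0"
    using h0(1) H.m_inv_closed by (metis linorder_neqE_linordered_idom neg_0_less_iff_less)
  define k where "k = snd h"
  have k: "k > 0" using h(2) by (simp add: k_def)
  have "\<exists>x \<in> H. snd x = k * q" for q
  proof -
    have pow_mem: "h [^]\<^bsub>G\<^esub> n \<in> H" for n :: nat
      using h(1) by (induction n) auto
    have snd_h: "snd (h [^]\<^bsub>G\<^esub> n) = k * int n" for n :: nat
      by (simp add: snd_pow k_def)
    show ?thesis
    proof (cases "q \<ge> 0")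
      case True
      then show ?thesis using pow_mem[of "nat q"] snd_h[of "nat q"] by auto
    next
      case False
      then obtain n :: nat where q: "q = - int n"
        by (metis int_cases2 of_nat_0_le_iff)
      have "snd (inv\<^bsub>G\<^esub> (h [^]\<^bsub>G\<^esub> n)) = k * q"
        using pow_mem[of n] H(2) by (simp add: snd_inv snd_h q subset_iff)
      then show ?thesis using pow_mem[of n] by blast
    qed
  qed
  then obtain t where t: "\<And>q. t q \<in> H" "\<And>q. snd (t q) = k * q"
    by metis
  obtain F where F: "finite F" "F \<subseteq> carrier G"
      "\<And>x. x \<in> base UNIV \<Longrightarrow> \<exists>l\<in>H. \<exists>y\<in>F. x = l \<otimes>\<^bsub>G\<^esub> y"
    using inert_subgroup_almost_contains_base[OF assms(1) h]
    by (rule almost_containedE) blast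
  define s where "s = (\<lambda>r. elt (\<lambda>_. 0) r)"
  have s: "s r \<in> carrier G" for r
    by (simp add: s_def elt_mem_carrier_iff)
  show ?thesis
  proof (rule almost_containedI)
    show "finite ((\<lambda>(y, r). y \<otimes>\<^bsub>G\<^esub> s r) ` (F \<times> {0..<k}))"
      using F(1) by simp
    show "(\<lambda>(y, r). y \<otimes>\<^bsub>G\<^esub> s r) ` (F \<times> {0..<k}) \<subseteq> carrier G"
      using F(2) s by auto
  next
    fix x assume x: "x \<in> carrier G"
    define q r where "q = snd x div k" and "r = snd x mod k"
    have r: "r \<in> {0..<k}" using k by (simp add: r_def)
    have tq: "t q \<in> carrier G" "t (- q) \<in> carrier G"
      using t(1) H(2) by auto
    obtain f l where fl: "finite (supp f)" "t (- q) \<otimes>\<^bsub>G\<^esub> x = elt f l"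
      using x tq carrierE[of "t (- q) \<otimes>\<^bsub>G\<^esub> x"] by auto
    have "l = snd (t (- q)) + snd x"
      using fl(2) by (metis snd_elt snd_mult)
    also have "\<dots> = r"
      by (simp add: t(2) q_def r_def minus_mult_div_eq_mod)
    finally have l: "l = r" .
    have "elt f 0 \<in> base UNIV"
      using fl(1) by (simp add: elt_mem_base_iff)
    then obtain y z where yz: "y \<in> H" "z \<in> F" "elt f 0 = y \<otimes>\<^bsub>G\<^esub> z"
      using F(3) by blast
    have carr: "y \<in> carrier G" "z \<in> carrier G"
      using yz H(2) F(2) by auto
    have "t (- q) \<otimes>\<^bsub>G\<^esub> x = elt f 0 \<otimes>\<^bsub>G\<^esub> s r"
      by (simp add: fl(2) l s_def elt_mult)
    also have "\<dots> = y \<otimes>\<^bsub>G\<^esub> (z \<otimes>\<^bsub>G\<^esub> s r)"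
      using carr s by (simp add: yz(3) m_assoc)
    finally have "x = inv\<^bsub>G\<^esub> (t (- q)) \<otimes>\<^bsub>G\<^esub> (y \<otimes>\<^bsub>G\<^esub> (z \<otimes>\<^bsub>G\<^esub> s r))"
      using x tq carr s by (metis inv_solve_left m_closed)
    then have "x = (inv\<^bsub>G\<^esub> (t (- q)) \<otimes>\<^bsub>G\<^esub> y) \<otimes>\<^bsub>G\<^esub> (z \<otimes>\<^bsub>G\<^esub> s r)"
      using tq carr s by (simp add: m_assoc)
    moreover have "inv\<^bsub>G\<^esub> (t (- q)) \<otimes>\<^bsub>G\<^esub> y \<in> H"
      using t(1) yz(1) by simp
    ultimately show "\<exists>l\<in>H. \<exists>y\<in>(\<lambda>(y, r). y \<otimes>\<^bsub>G\<^esub> s r) ` (F \<times> {0..<k}). x = l \<otimes>\<^bsub>G\<^esub> y"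
      using yz(2) r by (intro bexI) auto
  qed
qed

section \<open>The five classes\<close>

lemma base_almost_contained_iff: "almost_contained G (base S) (base T) \<longleftrightarrow> finite (S - T)"
proof
  assume "finite (S - T)"
  then obtain N where "S - T \<subseteq> {-N..N}"
    by (rule finite_int_subset_interval)
  then show "almost_contained G (base S) (base T)"
    by (intro almost_contained_baseI[of _ _ N]) (auto simp: base_def[of UNIV] elt_mem_base_iff elim: mem_baseE)
next
  assume "almost_contained G (base S) (base T)"
  moreover have "base T \<subseteq> base UNIV" by (auto simp: base_def)
  ultimately obtain N where N: "\<And>f. elt f 0 \<in> base S \<Longrightarrow>
      \<exists>g. elt g 0 \<in> base T \<and> supp (\<lambda>i. f i - g i) \<subseteq> {-N..N}"
    by (rule base_almost_containedE) blast
  \<comment> \<open>The monomial at a point of S - T differs there from every element supported in T.\<close>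
  have "S - T \<subseteq> {-N..N}"
  proof
    fix i assume i: "i \<in> S - T"
    then obtain g where g: "supp g \<subseteq> T" "supp (\<lambda>x. delta i x - g x) \<subseteq> {-N..N}"
      using N[of "delta i"] by (auto simp: elt_mem_base_iff)
    have "int p dvd g i"
      using i g(1) by (auto simp: supp_def)
    then have "i \<in> supp (\<lambda>x. delta i x - g x)"
      using p_gt_1 by (auto simp: supp_def delta_def dvd_diff_left_iff)
    then show "i \<in> {-N..N}" using g(2) by blast
  qed
  then show "finite (S - T)"
    by (rule finite_subset) simp
qed

text \<open>
  No positive power of a nontrivial translation of the lamps lies in the base group.
\<close>

lemma not_carrier_almost_contained_base: "\<not> almost_contained G (carrier G) (base S)"
proof
  assume "almost_contained G (carrier G) (base S)"
  moreover have "elt (\<lambda>_. 0) 1 \<in> carrier G"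
    by (simp add: elt_mem_carrier_iff)
  ultimately obtain n :: nat where n: "n > 0" "elt (\<lambda>_. 0) 1 [^]\<^bsub>G\<^esub> n \<in> base S"
    using almost_contained_imp_power_mem subgroup_self subgroup_base by blast
  have "snd x = 0" if "x \<in> base S" for x
    using that by (elim mem_baseE) simp
  then have "snd (elt (\<lambda>_. 0) 1 [^]\<^bsub>G\<^esub> n) = 0" using n(2) by blast
  then show False using n(1) by (simp add: snd_pow)
qed

lemma conjugate_base:
  assumes "finite (supp c)"
  shows "conjugate_subgroup G (base S) (elt c k) = base {i. i + k \<in> S}"
proof (rule Set.set_eqI)
  fix x
  have iff: "x \<in> conjugate_subgroup G (base S) (elt c k) \<longleftrightarrow>
      x \<in> carrier G \<and> elt c k \<otimes>\<^bsub>G\<^esub> x \<otimes>\<^bsub>G\<^esub> inv\<^bsub>G\<^esub> (elt c k) \<in> base S"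
    using assms by (intro mem_conjugate_subgroup_iff)
      (simp_all add: subgroup_base subgroup.subset elt_mem_carrier_iff)
  show "x \<in> conjugate_subgroup G (base S) (elt c k) \<longleftrightarrow> x \<in> base {i. i + k \<in> S}"
  proof (cases "x \<in> carrier G")
    case True
    then obtain f l where "finite (supp f)" "x = elt f l" by (rule carrierE)
    then show ?thesis
      unfolding iff by (auto simp: elt_conj assms elt_mem_base_iff elt_mem_carrier_iff
          supp_shift_right image_subset_iff)
  next
    case False
    then show ?thesis
      using iff subgroup.subset[OF subgroup_base] by blast
  qed
qed

text \<open>
  The conjugates of \<open>base S\<close> are the groups belonging to the translates of \<open>S\<close>, so inertness says that
  \<open>S\<close> is almost invariant under translation.
\<close>

lemma inert_base:
  assumes "\<And>k. finite {i \<in> S. i + k \<notin> S}"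
  shows "inert_subgroup (base S) G"
  unfolding inert_subgroup_iff
proof (intro conjI ballI)
  show "subgroup (base S) G" by (rule subgroup_base)
  fix g assume "g \<in> carrier G"
  then obtain c k where g: "finite (supp c)" "g = elt c k" by (rule carrierE)
  have "S - {i. i + k \<in> S} = {i \<in> S. i + k \<notin> S}" by auto
  then show "almost_contained G (base S) (conjugate_subgroup G (base S) g)"
    using assms by (simp add: g conjugate_base base_almost_contained_iff)
  have "{i. i + k \<in> S} - S \<subseteq> (\<lambda>i. i - k) ` {i \<in> S. i + - k \<notin> S}"
  proof
    fix i assume "i \<in> {i. i + k \<in> S} - S"
    then show "i \<in> (\<lambda>i. i - k) ` {i \<in> S. i + - k \<notin> S}"
      by (intro image_eqI[of _ _ "i + k"]) auto
  qed
  then have "finite ({i. i + k \<in> S} - S)"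
    using assms by (meson finite_imageI finite_subset)
  then show "almost_contained G (conjugate_subgroup G (base S) g) (base S)"
    by (simp add: g conjugate_base base_almost_contained_iff)
qed

lemma inert_carrier: "inert_subgroup (carrier G) G"
proof -
  have "conjugate_subgroup G (carrier G) g = carrier G" if "g \<in> carrier G" for g
    using that by (auto simp: mem_conjugate_subgroup_iff)
  then show ?thesis
    by (simp add: inert_subgroup_iff subgroup_self almost_contained_subset)
qed

abbreviation cclass where "cclass H \<equiv> commensurability G `` {H}"

lemma inert_quotient_eq:
  "{H. inert_subgroup H G} // commensurability G =
    {cclass (base {}), cclass (base {0..}), cclass (base {..0}), cclass (base UNIV),
     cclass (carrier G)}"
proof (rule Set.set_eqI, rule iffI)
  fix C assume "C \<in> {H. inert_subgroup H G} // commensurability G"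
  then obtain H where H: "inert_subgroup H G" "C = cclass H"
    by (auto simp: quotient_def)
  then have sub: "subgroup H G" by (simp add: inert_subgroup_iff)
  show "C \<in> {cclass (base {}), cclass (base {0..}), cclass (base {..0}), cclass (base UNIV),
     cclass (carrier G)}"
  proof (cases "H \<subseteq> base UNIV")
    case True
    then obtain S where S: "S \<in> {{}, {0..}, {..0}, UNIV}"
        "almost_contained G H (base S)" "almost_contained G (base S) H"
      using inert_subgroup_of_base[OF H(1)] by blast
    then have "C = cclass (base S)"
      by (simp add: H(2) commensurability_class_eq_iff commensurate_iff sub subgroup_base)
    then show ?thesis using S(1) by blast
  next
    case False
    then have "almost_contained G (carrier G) H"
      by (rule inert_subgroup_not_in_base[OF H(1)])
    moreover have "almost_contained G H (carrier G)"
      using sub by (simp add: almost_contained_subset subgroup.subset)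
    ultimately have "C = cclass (carrier G)"
      by (simp add: H(2) commensurability_class_eq_iff commensurate_iff sub subgroup_self)
    then show ?thesis by blast
  qed
next
  fix C assume C: "C \<in> {cclass (base {}), cclass (base {0..}), cclass (base {..0}),
    cclass (base UNIV), cclass (carrier G)}"
  have "{i \<in> {0..}. i + k \<notin> {0..}} \<subseteq> {0..-k}" "{i \<in> {..0}. i + k \<notin> {..0}} \<subseteq> {-k..0}" for k :: int
    by auto
  then have "inert_subgroup (base {0..}) G" "inert_subgroup (base {..0}) G"
    by (intro inert_base; meson finite_atLeastAtMost_int finite_subset)+
  moreover have "inert_subgroup (base {}) G" "inert_subgroup (base UNIV) G"
    by (intro inert_base; simp)+
  ultimately show "C \<in> {H. inert_subgroup H G} // commensurability G"
    using C inert_carrier by (auto intro: quotientI)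
qed

lemma card_inert_quotient: "card ({H. inert_subgroup H G} // commensurability G) = 5"
proof -
  have base_eq: "cclass (base S) = cclass (base T) \<longleftrightarrow> finite (S - T) \<and> finite (T - S)" for S T
    by (simp add: commensurability_class_eq_iff commensurate_iff subgroup_base
        base_almost_contained_iff)
  have carrier_neq: "cclass (base S) \<noteq> cclass (carrier G)" for S
    by (simp add: commensurability_class_eq_iff commensurate_iff subgroup_base subgroup_self
        not_carrier_almost_contained_base)
  have inf: "infinite {0 :: int..}" "infinite {..0 :: int}" "infinite (UNIV :: int set)"
    by (simp_all add: infinite_Ici infinite_Iic infinite_UNIV_int)
  have "{0 :: int..} - {..0} = {1..}" "UNIV - {0 :: int..} = {..-1}" "UNIV - {..0 :: int} = {1..}"
    by auto
  then have "infinite ({0 :: int..} - {..0})" "infinite (UNIV - {0 :: int..})"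
      "infinite (UNIV - {..0 :: int})"
    by (simp_all only: infinite_Ici infinite_Iic not_False_eq_True)
  then show ?thesis
    unfolding inert_quotient_eq using inf by (simp add: base_eq carrier_neq)
qed

end

theorem mainTheorem1:
  fixes p :: nat
  assumes "Factorial_Ring.prime p"
  shows "card ({H. inert_subgroup H (lamplighter_group p)} //
               commensurability (lamplighter_group p)) = 5"
proof -
  interpret lamplighter p by unfold_locales fact
  show ?thesis by (rule card_inert_quotient)
qed

end
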